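(* Let $(\mathcal{E},\cdot)$ be a Leibniz algebra over a field $\mathbb{K}$ of characteristic $0$ with enveloping Lie algebra $(\mathfrak{g},\mathfrak{h},f)$, let $\pi_{\mathcal{E}}:\mathfrak{g}=\mathfrak{h}\ltimes\mathcal{E}\to\mathcal{E}$ be the projection $(\xi,x)\mapsto x$ onto the second factor, and let $\sigma_{1/2}:\mathcal{E}\to\mathfrak{g}$ be defined by $\sigma_{1/2}(x)=(\tfrac12 f(x),x)$. Then the skew-symmetrized product $[\![x,y]\!]=\tfrac12(x\cdot y-y\cdot x)$ is given in terms of the Lie bracket of $\mathfrak{g}$ by $$[\![x,y]\!]=\pi_{\mathcal{E}}\bigl([\sigma_{1/2}(x),\sigma_{1/2}(y)]\bigr)$$ for all $x,y\in\mathcal{E}$.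
   Context: An algebra $(\mathcal{E},\cdot)$ is a $\mathbb{K}$-vector space with a (not necessarily associative) bilinear operation. It is a (left) Leibniz algebra if $x\cdot(y\cdot z)=(x\cdot y)\cdot z+y\cdot(x\cdot z)$ for all $x,y,z\in\mathcal{E}$. $\mathrm{Der}(\mathcal{E})$ is the Lie algebra of derivations of $(\mathcal{E},\cdot)$. Enveloping Lie algebra: let $\mathfrak{h}$ be a Lie algebra with a derivation action on $\mathcal{E}$, i.e. a Lie algebra homomorphism $\mathfrak{h}\to\mathrm{Der}(\mathcal{E})$, written $(\xi,x)\mapsto\xi x$, and let $f:\mathcal{E}\to\mathfrak{h}$ be a linear map such that $[\xi,f(x)]=f(\xi x)$ and $f(x)y=x\cdot y$ for all $\xi\in\mathfrak{h}$, $x,y\in\mathcal{E}$. Let $\mathfrak{g}=\mathfrak{h}\ltimes\mathcal{E}$ be the semidirect product Lie algebra, with $\mathcal{E}$ regarded as a Lie algebra with zero bracket, so $[(\xi,x),(\eta,y)]=([\xi,\eta],\xi y-\eta x)$. Then the triple $(\mathfrak{g},\mathfrak{h},f)$ is called an enveloping Lie algebra of $(\mathcal{E},\cdot)$. *)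

theory Defs
  imports "HOL-Analysis.Product_Vector"
begin

text \<open>
  Vector spaces over an arbitrary field are, as in \<open>HOL.Vector_Spaces\<close>, whole types
  of class \<^class>\<open>ab_group_add\<close> with an explicit scalar multiplication.
\<close>

locale nonassoc_algebra = vector_space smult
  for smult :: "'k::field \<Rightarrow> 'a::ab_group_add \<Rightarrow> 'a" +
  fixes mult :: "'a \<Rightarrow> 'a \<Rightarrow> 'a"
  assumes linear_mult_left: "Vector_Spaces.linear smult smult (\<lambda>x. mult x y)"
    and linear_mult_right: "Vector_Spaces.linear smult smult (\<lambda>y. mult x y)"

locale leibniz_algebra = nonassoc_algebra smult mult
  for smult :: "'k::field \<Rightarrow> 'a::ab_group_add \<Rightarrow> 'a" and mult :: "'a \<Rightarrow> 'a \<Rightarrow> 'a" +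
  assumes left_leibniz: "mult x (mult y z) = mult (mult x y) z + mult y (mult x z)"

locale lie_algebra = nonassoc_algebra smult bracket
  for smult :: "'k::field \<Rightarrow> 'a::ab_group_add \<Rightarrow> 'a" and bracket :: "'a \<Rightarrow> 'a \<Rightarrow> 'a" +
  assumes bracket_self: "bracket x x = 0"
    and jacobi: "bracket x (bracket y z) + bracket y (bracket z x) + bracket z (bracket x y) = 0"

definition Der :: "('k::field \<Rightarrow> 'a::ab_group_add \<Rightarrow> 'a) \<Rightarrow> ('a \<Rightarrow> 'a \<Rightarrow> 'a) \<Rightarrow> ('a \<Rightarrow> 'a) set" where
  "Der smult mult =
     {D. Vector_Spaces.linear smult smult D \<and>
         (\<forall>x y. D (mult x y) = mult (D x) y + mult x (D y))}"

definition commutator :: "('a::ab_group_add \<Rightarrow> 'a) \<Rightarrow> ('a \<Rightarrow> 'a) \<Rightarrow> 'a \<Rightarrow> 'a" where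
  "commutator D D' = (\<lambda>x. D (D' x) - D' (D x))"

text \<open>
  A Lie algebra homomorphism \<open>act\<close> from \<open>\<hh>\<close> to the derivations. Since \<^const>\<open>Der\<close> is a subspace
  of a function space, linearity of \<open>act\<close> is stated pointwise (\<open>act_linear\<close>).
\<close>

locale derivation_action =
  E: nonassoc_algebra scaleE mult + H: lie_algebra scaleH bracketH
  for scaleE :: "'k::field \<Rightarrow> 'e::ab_group_add \<Rightarrow> 'e"
    and mult :: "'e \<Rightarrow> 'e \<Rightarrow> 'e"
    and scaleH :: "'k \<Rightarrow> 'h::ab_group_add \<Rightarrow> 'h"
    and bracketH :: "'h \<Rightarrow> 'h \<Rightarrow> 'h" +
  fixes act :: "'h \<Rightarrow> 'e \<Rightarrow> 'e"
  assumes act_Der: "act \<xi> \<in> Der scaleE mult"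
    and act_linear: "Vector_Spaces.linear scaleH scaleE (\<lambda>\<xi>. act \<xi> x)"
    and act_bracket: "act (bracketH \<xi> \<eta>) = commutator (act \<xi>) (act \<eta>)"

definition semidirect_bracket ::
  "('h \<Rightarrow> 'h \<Rightarrow> 'h) \<Rightarrow> ('h \<Rightarrow> 'e::ab_group_add \<Rightarrow> 'e) \<Rightarrow> 'h \<times> 'e \<Rightarrow> 'h \<times> 'e \<Rightarrow> 'h \<times> 'e" where
  "semidirect_bracket bracketH act =
     (\<lambda>(\<xi>, x) (\<eta>, y). (bracketH \<xi> \<eta>, act \<xi> y - act \<eta> x))"

text \<open>
  The Lie algebra \<open>\<gg>\<close> of an enveloping triple \<open>(\<gg>, \<hh>, f)\<close> is determined by \<open>\<hh>\<close> and its action: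
  it is the type \<^typ>\<open>'h \<times> 'e\<close> with the bracket \<^const>\<open>semidirect_bracket\<close>; see
  \<open>lie_algebra_semidirect\<close> below.
\<close>

locale enveloping_lie_algebra = derivation_action scaleE mult scaleH bracketH act
  for scaleE :: "'k::field \<Rightarrow> 'e::ab_group_add \<Rightarrow> 'e"
    and mult :: "'e \<Rightarrow> 'e \<Rightarrow> 'e"
    and scaleH :: "'k \<Rightarrow> 'h::ab_group_add \<Rightarrow> 'h"
    and bracketH :: "'h \<Rightarrow> 'h \<Rightarrow> 'h"
    and act :: "'h \<Rightarrow> 'e \<Rightarrow> 'e" +
  fixes f :: "'e \<Rightarrow> 'h"
  assumes f_linear: "Vector_Spaces.linear scaleE scaleH f"
    and f_equivariant: "bracketH \<xi> (f x) = f (act \<xi> x)"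
    and act_f: "act (f x) y = mult x y"

definition sigma_half ::
  "('k::field \<Rightarrow> 'h \<Rightarrow> 'h) \<Rightarrow> ('e \<Rightarrow> 'h) \<Rightarrow> 'e \<Rightarrow> 'h \<times> 'e" where
  "sigma_half scaleH f x = (scaleH (1/2) (f x), x)"

definition skew_product ::
  "('k::field \<Rightarrow> 'a::ab_group_add \<Rightarrow> 'a) \<Rightarrow> ('a \<Rightarrow> 'a \<Rightarrow> 'a) \<Rightarrow> 'a \<Rightarrow> 'a \<Rightarrow> 'a" where
  "skew_product smult mult x y = smult (1/2) (mult x y - mult y x)"

lemma (in derivation_action) lie_algebra_semidirect:
  "lie_algebra (module_prod.scale scaleH scaleE) (semidirect_bracket bracketH act)"
proof -
  interpret P: vector_space_prod scaleH scaleE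
    by unfold_locales
  have p_scale: "P.scale c v = (scaleH c (fst v), scaleE c (snd v))" for c v
    by (rule P.scale_def)
  have act_lin: "Vector_Spaces.linear scaleE scaleE (act \<xi>)" for \<xi>
    using act_Der[of \<xi>] by (simp add: Der_def)
  have a1: "act \<xi> (x + y) = act \<xi> x + act \<xi> y" "act \<xi> (scaleE c x) = scaleE c (act \<xi> x)" for \<xi> x y c
    using act_lin[of \<xi>] by (simp_all add: Vector_Spaces.linear_iff)
  have a2: "act (\<xi> + \<eta>) x = act \<xi> x + act \<eta> x" "act (scaleH c \<xi>) x = scaleE c (act \<xi> x)" for \<xi> \<eta> x c
    using act_linear[of x] by (simp_all add: Vector_Spaces.linear_iff)
  have a3: "act \<xi> (x - y) = act \<xi> x - act \<xi> y" for \<xi> x y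
    using a1(1)[of \<xi> "x - y" y] by (simp add: eq_diff_eq)
  have b: "bracketH (\<xi> + \<xi>') \<eta> = bracketH \<xi> \<eta> + bracketH \<xi>' \<eta>"
     "bracketH (scaleH c \<xi>) \<eta> = scaleH c (bracketH \<xi> \<eta>)"
     "bracketH \<eta> (\<xi> + \<xi>') = bracketH \<eta> \<xi> + bracketH \<eta> \<xi>'"
     "bracketH \<eta> (scaleH c \<xi>) = scaleH c (bracketH \<eta> \<xi>)" for \<xi> \<xi>' \<eta> c
    using H.linear_mult_left[of \<eta>] H.linear_mult_right[of \<eta>]
    by (simp_all add: Vector_Spaces.linear_iff)
  show ?thesis
    by unfold_locales
      (auto simp: semidirect_bracket_def p_scale a1 a2 a3 b act_bracket commutator_def
        H.bracket_self H.jacobi[unfolded add.assoc] zero_prod_def E.scale_right_diff_distrib H.scale_right_distrib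
        algebra_simps split: prod.splits)
qed

end

theory Submission
  imports Defs
begin

text \<open>
  The action through \<open>f\<close> is left multiplication, so the \<open>\<E>\<close>-component of the bracket of two
  elements \<open>(t f(x), x)\<close> and \<open>(t f(y), y)\<close> is \<open>t (x \<cdot> y - y \<cdot> x)\<close> for every scalar \<open>t\<close>; the value
  \<open>t = 1/2\<close> is the one that produces the skew-symmetrized product.
\<close>

theorem theorem2p9:
  fixes scaleE :: "'k::field_char_0 \<Rightarrow> 'e::ab_group_add \<Rightarrow> 'e"
    and mult :: "'e \<Rightarrow> 'e \<Rightarrow> 'e"
    and scaleH :: "'k \<Rightarrow> 'h::ab_group_add \<Rightarrow> 'h"
    and bracketH :: "'h \<Rightarrow> 'h \<Rightarrow> 'h"
    and act :: "'h \<Rightarrow> 'e \<Rightarrow> 'e"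
    and f :: "'e \<Rightarrow> 'h"
  assumes "leibniz_algebra scaleE mult"
    and "enveloping_lie_algebra scaleE mult scaleH bracketH act f"
  shows "\<forall>x y. skew_product scaleE mult x y =
    snd (semidirect_bracket bracketH act (sigma_half scaleH f x) (sigma_half scaleH f y))"
proof -
  interpret enveloping_lie_algebra scaleE mult scaleH bracketH act f
    by (rule assms(2))
  have "act (scaleH (1/2) (f x)) y = scaleE (1/2) (mult x y)" for x y
    using act_linear[of y] by (simp add: Vector_Spaces.linear_iff act_f)
  then show ?thesis
    by (simp add: skew_product_def semidirect_bracket_def sigma_half_def
        E.scale_right_diff_distrib)
qed

end
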